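(* Let $m$ and $d$ be integers such that (i) $m \geq 4$; (ii) $1 \leq d \leq m-2$ and $d \neq m/2$; (iii) if $d < m/2$, then $d \neq m/3$; (iv) if $d > m/2$, then $d \neq 2m/3$. For an integer $k \geq 3$, let \[ a^* = (k+2)m, \qquad B = [0,m-1]\setminus\{d\}, \] \[ L = \{2m-d, 3m-d, \ldots, km-d\} \cup \{2m+d, 3m+d, \ldots, km+d\}, \] \[ A^* = B \cup L \cup (\{a^*\} - B), \qquad A = A^* \cup \{m\}. \] Then $A$ is an MSTD set of integers, i.e. $|A+A| > |A-A|$.
   Context: For integers $a,b$, $[a,b]$ denotes the interval of integers $\{a,a+1,\ldots,b\}$. For sets $A,B$ of integers, $A+B=\{a+b : a\in A, b\in B\}$ and $A-B=\{a-b : a\in A, b\in B\}$. $|A|$ denotes cardinality. A finite set $A$ is called an MSTD set (more sums than differences) if $|A+A|>|A-A|$. *)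

theory Defs
  imports Main "HOL-Library.Set_Algebras"
begin

(* On sets, "+" from Set_Algebras is the Minkowski sum, but "-" is the
   set-theoretic difference, so the set A - B of all differences a - b
   needs its own constant. *)
definition diff_set :: "'a::minus set \<Rightarrow> 'a set \<Rightarrow> 'a set" where
  "diff_set A B = {a - b | a b. a \<in> A \<and> b \<in> B}"

definition MSTD :: "int set \<Rightarrow> bool" where
  "MSTD A \<longleftrightarrow> finite A \<and> card (A + A) > card (diff_set A A)"

end

theory Submission
  imports Defs
begin

text \<open>The set \<open>A_star\<close> is symmetric: \<open>x \<mapsto> a_star - x\<close> maps it to itself. For
  a symmetric set, the sums are the differences translated by \<open>a_star\<close>, so there are equally many
  of both. Adjoining the point \<open>m\<close> creates a new sum but no new difference, which tips the balance
  (lemma \<open>MSTD_insert_symmetric\<close>).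

  The new sum is \<open>2 * m\<close>: two elements of \<open>B\<close> have sum at most \<open>2 * m - 2\<close>, all other elements of
  \<open>A_star\<close> exceed \<open>m\<close>, and the only one of these below \<open>2 * m\<close> is \<open>2 * m - d\<close>. It would have to be
  paired with \<open>d\<close>, which has been deleted from \<open>B\<close>. That no difference is
  new means that \<open>x - m\<close> is a difference of two elements of \<open>A_star\<close> for each \<open>x\<close> in \<open>A_star\<close>; this
  is checked by exhibiting the two elements. The delicate case is \<open>x = 2 * m + d\<close>: the value \<open>m + d\<close>
  is reached as \<open>(2 * m - d) - (m - 2 * d)\<close> if \<open>2 * d < m\<close>, and as
  \<open>(3 * m - d) - (2 * m - 2 * d)\<close> if \<open>2 * d > m\<close>, and the elements subtracted here differ from \<open>d\<close>
  precisely because \<open>3 * d \<noteq> m\<close> and \<open>3 * d \<noteq> 2 * m\<close>, respectively.\<close>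

lemma diff_setI: "x \<in> S \<Longrightarrow> y \<in> T \<Longrightarrow> z = x - y \<Longrightarrow> z \<in> diff_set S T"
  unfolding diff_set_def by blast

lemma uminus_mem_diff_set:
  fixes S :: "'a::group_add set"
  assumes "z \<in> diff_set S S"
  shows "- z \<in> diff_set S S"
  using assms unfolding diff_set_def by (auto; metis minus_diff_eq)

lemma sumset_symmetric:
  fixes S :: "'a::ab_group_add set"
  assumes sym: "\<And>x. x \<in> S \<Longrightarrow> c - x \<in> S"
  shows "S + S = (+) c ` diff_set S S"
proof (intro equalityI subsetI)
  fix z assume "z \<in> S + S"
  then obtain x y where "x \<in> S" "y \<in> S" "z = x + y"
    by (rule set_plus_elim)
  then have "x - (c - y) \<in> diff_set S S" "z = c + (x - (c - y))"
    using sym by (auto intro: diff_setI)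
  then show "z \<in> (+) c ` diff_set S S"
    by blast
next
  fix z assume "z \<in> (+) c ` diff_set S S"
  then obtain x y where xy: "x \<in> S" "y \<in> S" "z = c + (x - y)"
    unfolding diff_set_def by blast
  then have "z = x + (c - y)"
    by simp
  with xy sym show "z \<in> S + S"
    by (auto intro: set_plus_intro)
qed

lemma MSTD_insert_symmetric:
  assumes fin: "finite S"
    and nonempty: "S \<noteq> {}"
    and sym: "\<And>x. x \<in> S \<Longrightarrow> c - x \<in> S"
    and new_sum: "m + m \<notin> S + S"
    and no_new_diff: "\<And>x. x \<in> S \<Longrightarrow> x - m \<in> diff_set S S"
  shows "MSTD (S \<union> {m})"
proof -
  let ?A = "S \<union> {m}"
  have zero: "0 \<in> diff_set S S"
    using nonempty by (auto intro: diff_setI)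
  have "diff_set ?A ?A \<subseteq> diff_set S S"
  proof
    fix z assume "z \<in> diff_set ?A ?A"
    then obtain x y where xy: "x \<in> ?A" "y \<in> ?A" "z = x - y"
      unfolding diff_set_def by blast
    have "m - y \<in> diff_set S S" if "y \<in> S"
      using uminus_mem_diff_set[OF no_new_diff[OF that]] by simp
    with xy no_new_diff zero show "z \<in> diff_set S S"
      by (auto intro: diff_setI)
  qed
  moreover have finS: "finite (S + S)"
    using fin by (rule finite_set_plus[OF _ fin])
  moreover have S_plus: "S + S = (+) c ` diff_set S S"
    using sym by (rule sumset_symmetric)
  moreover have "finite (diff_set S S)"
    using finS unfolding S_plus by (rule finite_imageD) (simp add: inj_on_def)
  ultimately have "card (diff_set ?A ?A) \<le> card (S + S)"
    by (simp add: card_image card_mono)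
  also have "\<dots> < card (insert (m + m) (S + S))"
    using finS new_sum by simp
  also have "\<dots> \<le> card (?A + ?A)"
    using fin by (intro card_mono finite_set_plus) (auto simp: set_plus_def)
  finally show ?thesis
    using fin by (simp add: MSTD_def)
qed

theorem theorem3:
  fixes m d k a_star :: int and A A_star B L :: "int set"
  assumes "m \<ge> 4"
    and "1 \<le> d" and "d \<le> m - 2" and "2 * d \<noteq> m"
    and "2 * d < m \<Longrightarrow> 3 * d \<noteq> m"
    and "2 * d > m \<Longrightarrow> 3 * d \<noteq> 2 * m"
    and "k \<ge> 3"
    and "a_star = (k + 2) * m"
    and "B = {0..m - 1} - {d}"
    and "L = (\<lambda>j. j * m - d) ` {2..k} \<union> (\<lambda>j. j * m + d) ` {2..k}"
    and "A_star = B \<union> L \<union> diff_set {a_star} B"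
    and "A = A_star \<union> {m}"
  shows "MSTD A"
proof -
  note m = assms(1) and d = assms(2,3) and d_half = assms(4) and d_third = assms(5)
    and d_two_thirds = assms(6) and k = assms(7) and a_star = assms(8) and B = assms(9)
    and L = assms(10) and A_star = assms(11) and A = assms(12)
  have B_iff: "b \<in> B \<longleftrightarrow> 0 \<le> b \<and> b \<le> m - 1 \<and> b \<noteq> d" for b
    by (auto simp: B)
  have low_mem: "b \<in> A_star" if "0 \<le> b" "b \<le> m - 1" "b \<noteq> d" for b
    using that by (simp add: A_star B_iff)
  have top_mem: "a_star - b \<in> A_star" if "0 \<le> b" "b \<le> m - 1" "b \<noteq> d" for b
    using that by (auto simp: A_star diff_set_def B_iff)
  have mid_minus_mem: "j * m - d \<in> A_star" and mid_plus_mem: "j * m + d \<in> A_star"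
    if "2 \<le> j" "j \<le> k" for j
    using that by (auto simp: A_star L)
  have A_star_cases [consumes 1, case_names low mid_minus mid_plus top]: P
    if "x \<in> A_star"
      and "\<And>b. \<lbrakk>0 \<le> b; b \<le> m - 1; b \<noteq> d; x = b\<rbrakk> \<Longrightarrow> P"
      and "\<And>j. \<lbrakk>2 \<le> j; j \<le> k; x = j * m - d\<rbrakk> \<Longrightarrow> P"
      and "\<And>j. \<lbrakk>2 \<le> j; j \<le> k; x = j * m + d\<rbrakk> \<Longrightarrow> P"
      and "\<And>b. \<lbrakk>0 \<le> b; b \<le> m - 1; b \<noteq> d; x = a_star - b\<rbrakk> \<Longrightarrow> P"
    for x P
    using that by (auto simp: A_star L diff_set_def B_iff)
  have "MSTD (A_star \<union> {m})"
  proof (rule MSTD_insert_symmetric)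
    show "finite A_star"
    proof -
      have "diff_set {a_star} B = (\<lambda>b. a_star - b) ` B"
        by (auto simp: diff_set_def)
      then show ?thesis
        by (simp add: A_star B L)
    qed
  next
    show "A_star \<noteq> {}"
      using low_mem[of 0] m d by auto
  next
    show "a_star - x \<in> A_star" if "x \<in> A_star" for x
      using that
    proof (cases x rule: A_star_cases)
      case (low b)
      then show ?thesis
        using top_mem by simp
    next
      case (mid_minus j)
      then have "a_star - x = (k + 2 - j) * m + d"
        by (simp add: a_star algebra_simps)
      moreover have "(k + 2 - j) * m + d \<in> A_star"
        using mid_minus by (intro mid_plus_mem) auto
      ultimately show ?thesis
        by (simp only:)
    next
      case (mid_plus j)
      then have "a_star - x = (k + 2 - j) * m - d"
        by (simp add: a_star algebra_simps)
      moreover have "(k + 2 - j) * m - d \<in> A_star"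
        using mid_plus by (intro mid_minus_mem) auto
      ultimately show ?thesis
        by (simp only:)
    next
      case (top b)
      then show ?thesis
        using low_mem by simp
    qed
  next
    \<comment> \<open>Of two elements with sum \<open>2 * m\<close>, neither exceeds \<open>2 * m\<close>, as all elements are nonnegative.\<close>
    have above: "x \<in> B \<or> x = 2 * m - d \<or> x > 2 * m" if "x \<in> A_star" for x
      using that
    proof (cases x rule: A_star_cases)
      case (low b)
      then show ?thesis by (simp add: B_iff)
    next
      case (mid_minus j)
      show ?thesis
      proof (cases "j = 2")
        case True
        then show ?thesis using mid_minus by simp
      next
        case False
        then have "3 * m \<le> j * m"
          using mid_minus m by (intro mult_right_mono) auto
        then show ?thesis using mid_minus(3) d by linarith
      qed
    next
      case (mid_plus j)
      then have "2 * m \<le> j * m"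
        using m by (intro mult_right_mono) auto
      then show ?thesis using mid_plus(3) d by linarith
    next
      case (top b)
      have "5 * m \<le> a_star"
        unfolding a_star using m k by (intro mult_right_mono) auto
      then show ?thesis using top(2,4) m by linarith
    qed
    have nonneg: "x \<ge> 0" if "x \<in> A_star" for x
      using above[OF that] m d by (auto simp: B_iff)
    show "m + m \<notin> A_star + A_star"
    proof
      assume "m + m \<in> A_star + A_star"
      then obtain x y where xy: "x \<in> A_star" "y \<in> A_star" "m + m = x + y"
        by (rule set_plus_elim)
      then show False
        using above[OF xy(1)] above[OF xy(2)] nonneg[OF xy(1)] nonneg[OF xy(2)] m d
        by (auto simp: B_iff)
    qed
  next
    have small: "c \<in> diff_set A_star A_star" if "1 \<le> c" "c \<le> m - 1" "c \<noteq> m - d" for c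
    proof -
      consider "c \<noteq> d" | "c = d" "d \<noteq> 1" | "c = d" "d = 1"
        by blast
      then show ?thesis
      proof cases
        case 1
        then show ?thesis
          using that d by (intro diff_setI[OF low_mem[of c] low_mem[of 0]]) auto
      next
        case 2
        then show ?thesis
          using d by (intro diff_setI[OF low_mem[of "d + 1"] low_mem[of 1]]) auto
      next
        case 3
        then show ?thesis
          using m by (intro diff_setI[OF low_mem[of 3] low_mem[of 2]]) auto
      qed
    qed
    show "x - m \<in> diff_set A_star A_star" if "x \<in> A_star" for x
      using that
    proof (cases x rule: A_star_cases)
      case (low b)
      have "m - b \<in> diff_set A_star A_star"
      proof (cases "b = 0")
        case True
        then show ?thesis
          using k by (intro diff_setI[OF mid_minus_mem[of 3] mid_minus_mem[of 2]]) auto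
      next
        case False
        then show ?thesis
          using low by (intro small) auto
      qed
      then show ?thesis
        using uminus_mem_diff_set[of "m - b"] low by simp
    next
      case (mid_minus j)
      show ?thesis
      proof (cases "j = 2")
        case True
        have "m - d \<in> diff_set A_star A_star"
          using d d_half by (intro diff_setI[OF low_mem[of "m - d"] low_mem[of 0]]) auto
        then show ?thesis
          using True mid_minus by simp
      next
        case False
        have "x - m = ((j - 1) * m - d) - 0"
          using mid_minus by (simp add: algebra_simps)
        then show ?thesis
          using False mid_minus m d
          by (intro diff_setI[OF mid_minus_mem[of "j - 1"] low_mem[of 0]]) auto
      qed
    next
      case (mid_plus j)
      have "m + d \<in> diff_set A_star A_star"
      proof (cases "2 * d < m")
        case True
        then show ?thesis
          using d d_third k
          by (intro diff_setI[OF mid_minus_mem[of 2] low_mem[of "m - 2 * d"]]) auto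
      next
        case False
        then show ?thesis
          using d d_half d_two_thirds k
          by (intro diff_setI[OF mid_minus_mem[of 3] low_mem[of "2 * m - 2 * d"]]) auto
      qed
      moreover have "x - m = ((j - 1) * m + d) - 0"
        using mid_plus by (simp add: algebra_simps)
      ultimately show ?thesis
        using mid_plus m d
        by (cases "j = 2") (auto intro!: diff_setI[OF mid_plus_mem[of "j - 1"] low_mem[of 0]])
    next
      case (top b)
      \<comment> \<open>If \<open>m + b = p + q\<close> with \<open>p\<close> and \<open>q\<close> in \<open>B\<close>, then \<open>x - m = (a_star - p) - q\<close>. There are no
        such \<open>p\<close> and \<open>q\<close> if \<open>b = m - 1\<close>, or if \<open>b = m - 3\<close> and \<open>d = m - 2\<close>; the largest element
        \<open>k * m + d\<close> of \<open>L\<close> then serves as minuend.\<close>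
      have top_diff: "x - m \<in> diff_set A_star A_star"
        if "0 \<le> p" "p \<le> m - 1" "p \<noteq> d" "0 \<le> q" "q \<le> m - 1" "q \<noteq> d" "p + q = m + b" for p q
        using that top(4) by (intro diff_setI[OF top_mem[of p] low_mem[of q]]) auto
      have mid_diff: "x - m \<in> diff_set A_star A_star" if "m \<le> b + d"
      proof (rule diff_setI[OF mid_plus_mem[of k] low_mem[of "b + d - m"]])
        show "x - m = (k * m + d) - (b + d - m)"
          using top(4) by (simp add: a_star algebra_simps)
      qed (use that top k d in auto)
      consider "b = m - 1" | "b < m - 1" "b + 1 \<noteq> d" | "b + 1 = d" "d \<noteq> m - 2"
        | "b + 1 = d" "d = m - 2"
        using top(2) by linarith
      then show ?thesis
      proof cases
        case 1
        then show ?thesis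
          using mid_diff d by simp
      next
        case 2
        then show ?thesis
          using top_diff[of "b + 1" "m - 1"] top(1) d by simp
      next
        case 3
        then show ?thesis
          using top_diff[of "b + 2" "m - 2"] top(1) m d by simp
      next
        case 4
        \<comment> \<open>The subtrahend \<open>b + d - m = m - 5\<close> is nonnegative, since \<open>m = 4\<close> would give \<open>2 * d = m\<close>.\<close>
        then show ?thesis
          using mid_diff m d_half by simp
      qed
    qed
  qed
  then show ?thesis
    by (simp add: A)
qed

end
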